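(* Let $K$ be a field, $R=K[x_1,\dots,x_n]$, and let $I\subset R$ be a nonzero proper monomial ideal of big-height $h$. If $I$ has a standard linear weighting, then $$\hat{\alpha}(I)\;\ge\;\frac{\alpha(I)+h-1}{h}.$$
   Context: $[n]=\{1,\dots,n\}$; $\mathbb{N}$ is the set of non-negative integers. For $a=(a_1,\dots,a_n)\in\mathbb{N}^n$, $x^a=x_1^{a_1}\cdots x_n^{a_n}$. Standard linear weighting: a tuple $w=(w_1,\dots,w_n)$ of positive integers, acting by $w(a)=(w_1a_1,\dots,w_na_n)$. For a monomial ideal $J\subset R$, the weighted monomial ideal is $J_w=\langle x^{w(a)} : x^a\in J\rangle$. A monomial ideal $I\subset R$ "has a standard linear weighting" if there exist a squarefree monomial ideal $J\subset R$ and a standard linear weighting $w$ with $I=J_w$. The big-height of $I$ is the maximum of the heights of its associated primes. For $s\ge 1$, the $s$-th symbolic power is $I^{(s)}=\bigcap_{\mathfrak{p}\in \mathrm{Ass}(I)}(I^sR_{\mathfrak{p}}\cap R)$, where $\mathrm{Ass}(I)$ is the set of associated primes of $I$. For a nonzero homogeneous ideal $L$, $\alpha(L)=\min\{d : L_d\neq 0\}$ is the least degree of a nonzero element of $L$. The Waldschmidt constant is $\hat{\alpha}(I)=\lim_{s\to\infty}\alpha(I^{(s)})/s$ (the limit exists). *)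

theory Defs
  imports
    Complex_Main
    "HOL-Library.Poly_Mapping"
    "HOL-Library.Extended_Nat"
    "HOL-Algebra.Ideal_Product"
    "HOL-Algebra.Algebraic_Closure_Type"
    "HOL-Computational_Algebra.Fraction_Field"
begin

section \<open>Associated primes and height\<close>

text \<open>The associated primes of \<open>I\<close> are those of the module \<open>R/I\<close>, i.e. the primes of
  the form \<open>(I : f)\<close>.\<close>

definition associated_primes :: "('a, 'b) ring_scheme \<Rightarrow> 'a set \<Rightarrow> 'a set set" where
  "associated_primes R I =
     {P. primeideal P R \<and> (\<exists>f\<in>carrier R. P = {g \<in> carrier R. g \<otimes>\<^bsub>R\<^esub> f \<in> I})}"

definition height :: "('a, 'b) ring_scheme \<Rightarrow> 'a set \<Rightarrow> enat" where
  "height R P = Sup {enat k | k. \<exists>c :: nat \<Rightarrow> 'a set.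
     (\<forall>i\<le>k. primeideal (c i) R) \<and> (\<forall>i<k. c i \<subset> c (Suc i)) \<and> c k = P}"

definition big_height :: "('a, 'b) ring_scheme \<Rightarrow> 'a set \<Rightarrow> enat" where
  "big_height R I = (SUP P \<in> associated_primes R I. height R P)"

section \<open>Symbolic powers\<close>

text \<open>For a domain, the localization \<open>R\<^sub>P\<close> is realised inside the field of fractions, with
  \<open>R\<close> embedded by \<open>f \<mapsto> f/1\<close>.\<close>

definition localization :: "'a::idom set \<Rightarrow> 'a fract ring" where
  "localization P = ring_of_type_algebra \<lparr>carrier := {Fract a b | a b. b \<notin> P}\<rparr>"

definition local_contraction :: "'a::idom set \<Rightarrow> 'a set \<Rightarrow> 'a set" where
  "local_contraction P J =
     {f. Fract f 1 \<in> Idl\<^bsub>localization P\<^esub> ((\<lambda>g. Fract g 1) ` J)}"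

definition symbolic_power :: "'a::idom set \<Rightarrow> nat \<Rightarrow> 'a set" where
  "symbolic_power I s =
     (\<Inter>P \<in> associated_primes ring_of_type_algebra I.
        local_contraction P (I [^]\<^bsub>ideals_set ring_of_type_algebra\<^esub> s))"

section \<open>Polynomials and monomial ideals\<close>

text \<open>Polynomials over \<open>'k\<close> in variables indexed by a finite type \<open>'n\<close>; exponent vectors are
  elements of \<open>'n \<Rightarrow>\<^sub>0 nat\<close>. A linear order on \<open>'n\<close> is assumed below only because the library's
  \<open>idom\<close> instance for this type (needed for \<open>fract\<close>) asks for one.\<close>

type_synonym ('n, 'k) mpoly = "('n \<Rightarrow>\<^sub>0 nat) \<Rightarrow>\<^sub>0 'k"

definition monomial :: "('n \<Rightarrow>\<^sub>0 nat) \<Rightarrow> ('n, 'k::zero_neq_one) mpoly" where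
  "monomial a = Poly_Mapping.single a 1"

definition monomial_ideal :: "('n, 'k::field) mpoly set \<Rightarrow> bool" where
  "monomial_ideal I \<longleftrightarrow> (\<exists>A. I = Idl\<^bsub>ring_of_type_algebra\<^esub> (monomial ` A))"

definition squarefree_monomial_ideal :: "('n, 'k::field) mpoly set \<Rightarrow> bool" where
  "squarefree_monomial_ideal I \<longleftrightarrow>
     (\<exists>A. (\<forall>a\<in>A. \<forall>i. Poly_Mapping.lookup a i \<le> 1) \<and> I = Idl\<^bsub>ring_of_type_algebra\<^esub> (monomial ` A))"

definition standard_linear_weighting :: "('n \<Rightarrow> nat) \<Rightarrow> bool" where
  "standard_linear_weighting w \<longleftrightarrow> (\<forall>i. w i > 0)"

definition weight_exponent :: "('n \<Rightarrow> nat) \<Rightarrow> ('n \<Rightarrow>\<^sub>0 nat) \<Rightarrow> ('n \<Rightarrow>\<^sub>0 nat)" where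
  "weight_exponent w a = Poly_Mapping.mapp (\<lambda>i e. w i * e) a"

lemma lookup_weight_exponent [simp]: "Poly_Mapping.lookup (weight_exponent w a) i = w i * Poly_Mapping.lookup a i"
  by (simp add: weight_exponent_def lookup_mapp when_def in_keys_iff)

definition weighted_monomial_ideal ::
  "('n \<Rightarrow> nat) \<Rightarrow> ('n, 'k::field) mpoly set \<Rightarrow> ('n, 'k) mpoly set" where
  "weighted_monomial_ideal w J =
     Idl\<^bsub>ring_of_type_algebra\<^esub> {monomial (weight_exponent w a) | a. monomial a \<in> J}"

definition has_standard_linear_weighting :: "('n, 'k::field) mpoly set \<Rightarrow> bool" where
  "has_standard_linear_weighting I \<longleftrightarrow>
     (\<exists>J w. squarefree_monomial_ideal J \<and> standard_linear_weighting w \<and>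
            I = weighted_monomial_ideal w J)"

section \<open>Initial degree and Waldschmidt constant\<close>

definition total_degree :: "('n::finite \<Rightarrow>\<^sub>0 nat) \<Rightarrow> nat" where
  "total_degree a = (\<Sum>i\<in>UNIV. Poly_Mapping.lookup a i)"

definition homogeneous :: "nat \<Rightarrow> ('n::finite, 'k::zero) mpoly \<Rightarrow> bool" where
  "homogeneous d f \<longleftrightarrow> (\<forall>a\<in>Poly_Mapping.keys f. total_degree a = d)"

definition initial_degree :: "('n::finite, 'k::field) mpoly set \<Rightarrow> nat" where
  "initial_degree L = (LEAST d. \<exists>f\<in>L. f \<noteq> 0 \<and> homogeneous d f)"

definition waldschmidt_constant :: "('n::{finite,linorder}, 'k::field) mpoly set \<Rightarrow> real" where
  "waldschmidt_constant I =
     lim (\<lambda>s. real (initial_degree (symbolic_power I s)) / real s)"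

end

theory Submission
  imports Defs
begin

text \<open>Let \<open>\<S>\<close> be the set of supports of the generators of the squarefree ideal. For a minimal
  transversal \<open>C\<close> of \<open>\<S>\<close> the prime generated by the variables in \<open>C\<close> is associated to \<open>I\<close> and has
  height at least \<open>card C\<close>, so \<open>card C \<le> h\<close>. The weighted order
  \<open>v\<^sub>C(a) = (\<Sum>j\<in>C. a\<^sub>j / w\<^sub>j)\<close> is a valuation that is at least \<open>1\<close> on \<open>I\<close> and vanishes outside this prime;
  hence it is at least \<open>s\<close> on the \<open>s\<close>-th symbolic power. For a monomial \<open>x\<^sup>a\<close> occurring in an element
  of that power, \<open>y\<^sub>j = a\<^sub>j / (s w\<^sub>j)\<close> is therefore a fractional cover of the sets \<open>C\<close>, and its weight
  \<open>(\<Sum>j. w\<^sub>j y\<^sub>j) = deg x\<^sup>a / s\<close> is compared with the weights of the integral covers, each of which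
  contains a member of \<open>\<S>\<close> and so has weight at least the initial degree of \<open>I\<close>. The limit exists by
  subadditivity of the initial degrees.\<close>

section \<open>Ideals of type-class rings\<close>

text \<open>Negation is multiplication by minus one, so closure under addition and multiplication
  already yields the additive subgroup.\<close>

lemma (in cring) ideal_of_closed:
  assumes "I \<subseteq> carrier R" "\<zero> \<in> I"
    and add: "\<And>a b. a \<in> I \<Longrightarrow> b \<in> I \<Longrightarrow> a \<oplus> b \<in> I"
    and mult: "\<And>a x. a \<in> I \<Longrightarrow> x \<in> carrier R \<Longrightarrow> x \<otimes> a \<in> I"
  shows "ideal I R"
proof (rule idealI)
  show "ring R" by (rule ring_axioms)
  show "x \<otimes> a \<in> I" if "a \<in> I" "x \<in> carrier R" for a x
    using mult that by simp
  show "a \<otimes> x \<in> I" if "a \<in> I" "x \<in> carrier R" for a x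
    using mult[OF that] m_comm[of a x] that assms(1) by auto
  have neg: "\<ominus> a \<in> I" if "a \<in> I" for a
  proof -
    have "\<ominus> a = (\<ominus> \<one>) \<otimes> a"
      using that assms(1) by (simp add: l_minus subset_iff)
    then show ?thesis using mult[OF that, of "\<ominus> \<one>"] by simp
  qed
  show "subgroup I (add_monoid R)"
    using assms neg by (intro add.subgroupI) (auto simp: a_inv_def)
qed

lemma ring_of_type_algebra_simps [simp]:
  "carrier ring_of_type_algebra = UNIV"
  "monoid.mult ring_of_type_algebra = (*)"
  "one ring_of_type_algebra = 1"
  "zero ring_of_type_algebra = 0"
  "add ring_of_type_algebra = (+)"
  by (simp_all add: ring_of_type_algebra_def)

lemma ideal_type_iff:
  fixes I :: "'a::comm_ring_1 set"
  shows "ideal I ring_of_type_algebra \<longleftrightarrow>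
    0 \<in> I \<and> (\<forall>a\<in>I. \<forall>b\<in>I. a + b \<in> I) \<and> (\<forall>a\<in>I. \<forall>x. x * a \<in> I)"
proof
  assume "ideal I ring_of_type_algebra"
  then interpret ideal I "ring_of_type_algebra :: 'a ring" .
  show "0 \<in> I \<and> (\<forall>a\<in>I. \<forall>b\<in>I. a + b \<in> I) \<and> (\<forall>a\<in>I. \<forall>x. x * a \<in> I)"
    using additive_subgroup.zero_closed[OF is_additive_subgroup]
      additive_subgroup.a_closed[OF is_additive_subgroup] I_l_closed by auto
next
  interpret cring "ring_of_type_algebra :: 'a ring" ..
  assume "0 \<in> I \<and> (\<forall>a\<in>I. \<forall>b\<in>I. a + b \<in> I) \<and> (\<forall>a\<in>I. \<forall>x. x * a \<in> I)"
  then show "ideal I ring_of_type_algebra"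
    by (intro ideal_of_closed) auto
qed

lemma ideal_type_sum:
  fixes I :: "'a::comm_ring_1 set"
  assumes "ideal I ring_of_type_algebra" "\<And>x. x \<in> A \<Longrightarrow> f x \<in> I"
  shows "sum f A \<in> I"
  using assms(2) by (induction A rule: infinite_finite_induct) (use assms(1) in \<open>auto simp: ideal_type_iff\<close>)

lemma genideal_type:
  fixes A :: "'a::comm_ring_1 set"
  shows "ideal (Idl\<^bsub>ring_of_type_algebra\<^esub> A) ring_of_type_algebra"
    and "A \<subseteq> Idl\<^bsub>ring_of_type_algebra\<^esub> A"
    and "ideal I ring_of_type_algebra \<Longrightarrow> A \<subseteq> I \<Longrightarrow> Idl\<^bsub>ring_of_type_algebra\<^esub> A \<subseteq> I"
proof -
  interpret cring "ring_of_type_algebra :: 'a ring" ..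
  show "ideal (Idl\<^bsub>ring_of_type_algebra\<^esub> A) ring_of_type_algebra"
    by (rule genideal_ideal) simp
  show "A \<subseteq> Idl\<^bsub>ring_of_type_algebra\<^esub> A"
    by (rule genideal_self) simp
  show "ideal I ring_of_type_algebra \<Longrightarrow> A \<subseteq> I \<Longrightarrow> Idl\<^bsub>ring_of_type_algebra\<^esub> A \<subseteq> I"
    by (rule genideal_minimal)
qed

lemma primeideal_type_iff:
  fixes P :: "'a::comm_ring_1 set"
  shows "primeideal P ring_of_type_algebra \<longleftrightarrow>
    ideal P ring_of_type_algebra \<and> 1 \<notin> P \<and> (\<forall>a b. a * b \<in> P \<longrightarrow> a \<in> P \<or> b \<in> P)"
proof
  assume "primeideal P ring_of_type_algebra"
  then interpret primeideal P "ring_of_type_algebra :: 'a ring" .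
  have "1 \<notin> P"
    using I_notcarr one_imp_carrier by force
  then show "ideal P ring_of_type_algebra \<and> 1 \<notin> P \<and> (\<forall>a b. a * b \<in> P \<longrightarrow> a \<in> P \<or> b \<in> P)"
    using I_prime ideal_axioms by simp
next
  interpret cring "ring_of_type_algebra :: 'a ring" ..
  assume "ideal P ring_of_type_algebra \<and> 1 \<notin> P \<and> (\<forall>a b. a * b \<in> P \<longrightarrow> a \<in> P \<or> b \<in> P)"
  then show "primeideal P ring_of_type_algebra"
    using is_cring by (intro primeidealI) auto
qed

section \<open>Powers and symbolic powers\<close>

abbreviation ideal_power :: "'a::comm_ring_1 set \<Rightarrow> nat \<Rightarrow> 'a set" where
  "ideal_power I s \<equiv> I [^]\<^bsub>ideals_set ring_of_type_algebra\<^esub> s"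

lemma ideal_power_Suc: "ideal_power I (Suc s) = ideal_prod ring_of_type_algebra (ideal_power I s) I"
  by (simp add: ideals_set_def)

lemma ideal_ideal_power:
  fixes I :: "'a::comm_ring_1 set"
  assumes "ideal I ring_of_type_algebra"
  shows "ideal (ideal_power I s) ring_of_type_algebra"
proof -
  interpret cring "ring_of_type_algebra :: 'a ring" ..
  interpret L: comm_monoid "ideals_set (ring_of_type_algebra :: 'a ring)"
    by (rule ideals_set_is_comm_monoid)
  show ?thesis
    using L.nat_pow_closed[of I s] assms by (simp add: ideals_set_def)
qed

lemma ideal_power_mult_mem:
  fixes I :: "'a::comm_ring_1 set"
  assumes "ideal I ring_of_type_algebra" "f \<in> ideal_power I s" "g \<in> ideal_power I t"
  shows "f * g \<in> ideal_power I (s + t)"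
proof -
  interpret cring "ring_of_type_algebra :: 'a ring" ..
  interpret L: comm_monoid "ideals_set (ring_of_type_algebra :: 'a ring)"
    by (rule ideals_set_is_comm_monoid)
  have "ideal_power I (s + t) = ideal_prod ring_of_type_algebra (ideal_power I s) (ideal_power I t)"
    using L.nat_pow_mult[of I s t] assms(1) by (simp add: ideals_set_def)
  then show ?thesis
    using ideal_prod.prod[OF assms(2,3), of ring_of_type_algebra] by simp
qed

lemma power_mem_ideal_power:
  fixes I :: "'a::comm_ring_1 set"
  assumes "f \<in> I"
  shows "f ^ s \<in> ideal_power I s"
proof (induction s)
  case 0
  then show ?case by (simp add: ideals_set_def)
next
  case (Suc s)
  then show ?case
    using ideal_prod.prod[OF Suc assms, of ring_of_type_algebra]
    by (simp add: ideal_power_Suc mult.commute del: nat_pow_Suc)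
qed

section \<open>Localization and a denominator-free description of symbolic powers\<close>

lemma cring_localization:
  fixes P :: "'a::idom set"
  assumes "primeideal P ring_of_type_algebra"
  shows "cring (localization P)"
proof -
  interpret cring "ring_of_type_algebra :: 'a fract ring" ..
  let ?H = "{Fract a b | a b. b \<notin> P}"
  have nz: "b \<noteq> 0" if "b \<notin> P" for b
    using that assms by (auto simp: primeideal_type_iff ideal_type_iff)
  have mem: "Fract a b \<in> ?H" if "b \<notin> P" for a b
    using that by blast
  have mult: "b * d \<notin> P" if "b \<notin> P" "d \<notin> P" for b d
    using that assms by (auto simp: primeideal_type_iff)
  have uminus: "\<ominus>\<^bsub>ring_of_type_algebra\<^esub> x = - x" for x :: "'a fract"
    by (rule minus_equality) auto
  have "subring ?H (ring_of_type_algebra :: 'a fract ring)"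
  proof (rule subringI)
    show "\<one>\<^bsub>ring_of_type_algebra\<^esub> \<in> ?H"
      using assms mem[of 1 1] by (simp add: primeideal_type_iff One_fract_def)
    fix x assume "x \<in> ?H"
    then obtain a b where x: "x = Fract a b" "b \<notin> P" by blast
    show "\<ominus>\<^bsub>ring_of_type_algebra\<^esub> x \<in> ?H"
      using x mem[of b "- a"] by (simp add: uminus)
    fix y assume "y \<in> ?H"
    then obtain c d where y: "y = Fract c d" "d \<notin> P" by blast
    show "x \<otimes>\<^bsub>ring_of_type_algebra\<^esub> y \<in> ?H" "x \<oplus>\<^bsub>ring_of_type_algebra\<^esub> y \<in> ?H"
      using x y nz[of b] nz[of d] mem[OF mult[OF x(2) y(2)]] by simp_all
  qed simp
  then show ?thesis
    unfolding localization_def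
    using subcring_iff[of ?H] subcringI'[of ?H] by simp
qed

text \<open>The ideal that \<open>J\<close> generates in the localization is the set of fractions
  with numerator in \<open>J\<close>, and \<open>f/1\<close> is such a fraction exactly when
  clearing its denominator puts a multiple \<open>u * f\<close> into \<open>J\<close>. The
  multiplier \<open>u\<close> is what valuations can act on later.\<close>

lemma local_contraction_eq:
  fixes P J :: "'a::idom set"
  assumes P: "primeideal P ring_of_type_algebra" and J: "ideal J ring_of_type_algebra"
  shows "local_contraction P J = {f. \<exists>u. u \<notin> P \<and> u * f \<in> J}"
proof -
  interpret L: cring "localization P" by (rule cring_localization[OF P])
  have nz: "b \<noteq> 0" if "b \<notin> P" for b
    using that P by (auto simp: primeideal_type_iff ideal_type_iff)
  have mult: "b * d \<notin> P" if "b \<notin> P" "d \<notin> P" for b d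
    using that P by (auto simp: primeideal_type_iff)
  have one: "1 \<notin> P" using P by (auto simp: primeideal_type_iff)
  have carr: "carrier (localization P) = {Fract a b | a b. b \<notin> P}"
    and [simp]: "monoid.mult (localization P) = (*)" "add (localization P) = (+)" "zero (localization P) = 0"
    by (simp_all add: localization_def)
  have J0: "0 \<in> J" "\<And>a b. a \<in> J \<Longrightarrow> b \<in> J \<Longrightarrow> a + b \<in> J" "\<And>a x. a \<in> J \<Longrightarrow> x * a \<in> J"
    using J by (auto simp: ideal_type_iff)
  let ?G = "(\<lambda>g. Fract g 1) ` J"
  let ?M = "{Fract a b | a b. a \<in> J \<and> b \<notin> P}"
  have A: "?G \<subseteq> carrier (localization P)" using one by (auto simp: carr)
  have M: "ideal ?M (localization P)"
  proof (rule L.ideal_of_closed)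
    show "?M \<subseteq> carrier (localization P)" by (auto simp: carr)
    show "\<zero>\<^bsub>localization P\<^esub> \<in> ?M"
      using J0(1) one by (auto simp: Zero_fract_def)
    fix x assume "x \<in> ?M"
    then obtain a b where x: "x = Fract a b" "a \<in> J" "b \<notin> P" by blast
    { fix y assume "y \<in> ?M"
      then obtain c d where y: "y = Fract c d" "c \<in> J" "d \<notin> P" by blast
      have "x + y = Fract (a * d + c * b) (b * d)"
        using x y nz by simp
      moreover have "a * d + c * b \<in> J"
        using J0 x y by (metis mult.commute)
      ultimately show "x \<oplus>\<^bsub>localization P\<^esub> y \<in> ?M"
        using mult[OF x(3) y(3)] by auto }
    { fix y assume "y \<in> carrier (localization P)"
      then obtain c d where y: "y = Fract c d" "d \<notin> P" by (auto simp: carr)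
      have "y * x = Fract (c * a) (d * b)" using x y by simp
      then show "y \<otimes>\<^bsub>localization P\<^esub> x \<in> ?M"
        using mult[OF y(2) x(3)] J0(3)[OF x(2)] by auto }
  qed
  have "Idl\<^bsub>localization P\<^esub> ?G = ?M"
  proof
    show "Idl\<^bsub>localization P\<^esub> ?G \<subseteq> ?M"
      by (rule L.genideal_minimal[OF M]) (use one in auto)
    interpret I: ideal "Idl\<^bsub>localization P\<^esub> ?G" "localization P"
      by (rule L.genideal_ideal[OF A])
    show "?M \<subseteq> Idl\<^bsub>localization P\<^esub> ?G"
    proof
      fix x assume "x \<in> ?M"
      then obtain a b where x: "x = Fract a b" "a \<in> J" "b \<notin> P" by blast
      have "Fract 1 b * Fract a 1 \<in> Idl\<^bsub>localization P\<^esub> ?G"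
        using I.I_l_closed[of "Fract a 1" "Fract 1 b"] L.genideal_self[OF A] x
        by (auto simp: carr)
      then show "x \<in> Idl\<^bsub>localization P\<^esub> ?G" using x by simp
    qed
  qed
  moreover have "Fract f 1 \<in> ?M \<longleftrightarrow> (\<exists>u. u \<notin> P \<and> u * f \<in> J)" for f
  proof
    assume "Fract f 1 \<in> ?M"
    then obtain a b where ab: "Fract f 1 = Fract a b" "a \<in> J" "b \<notin> P" by blast
    then have "b * f = a" using nz[of b] by (simp add: eq_fract mult.commute)
    then show "\<exists>u. u \<notin> P \<and> u * f \<in> J" using ab by blast
  next
    assume "\<exists>u. u \<notin> P \<and> u * f \<in> J"
    then obtain u where u: "u \<notin> P" "u * f \<in> J" by blast
    have "Fract f 1 = Fract (u * f) u"
      using nz[OF u(1)] by (simp add: eq_fract mult.commute)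
    then show "Fract f 1 \<in> ?M" using u by blast
  qed
  ultimately show ?thesis by (simp add: local_contraction_def)
qed

lemma mem_symbolic_power_iff:
  fixes I :: "'a::idom set"
  assumes "ideal I ring_of_type_algebra"
  shows "f \<in> symbolic_power I s \<longleftrightarrow>
    (\<forall>P\<in>associated_primes ring_of_type_algebra I. \<exists>u. u \<notin> P \<and> u * f \<in> ideal_power I s)"
proof -
  have "local_contraction P (ideal_power I s) = {f. \<exists>u. u \<notin> P \<and> u * f \<in> ideal_power I s}"
    if "P \<in> associated_primes ring_of_type_algebra I" for P
    using that by (intro local_contraction_eq ideal_ideal_power assms) (simp add: associated_primes_def)
  then show ?thesis
    by (simp add: symbolic_power_def)
qed

text \<open>The multipliers of the two factors combine because the complement of a prime is
  multiplicatively closed. This yields subadditivity of the initial degrees.\<close>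

lemma symbolic_power_mult_mem:
  fixes I :: "'a::idom set"
  assumes I: "ideal I ring_of_type_algebra"
    and f: "f \<in> symbolic_power I s" and g: "g \<in> symbolic_power I t"
  shows "f * g \<in> symbolic_power I (s + t)"
  unfolding mem_symbolic_power_iff[OF I]
proof
  fix P :: "'a set" assume P: "P \<in> associated_primes ring_of_type_algebra I"
  obtain u where u: "u \<notin> P" "u * f \<in> ideal_power I s"
    using f P by (auto simp: mem_symbolic_power_iff[OF I])
  obtain v where v: "v \<notin> P" "v * g \<in> ideal_power I t"
    using g P by (auto simp: mem_symbolic_power_iff[OF I])
  have "u * v \<notin> P"
    using P u v by (auto simp: associated_primes_def primeideal_type_iff)
  moreover have "(u * v) * (f * g) \<in> ideal_power I (s + t)"
    using ideal_power_mult_mem[OF I u(2) v(2)] by (simp add: mult_ac)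
  ultimately show "\<exists>w. w \<notin> P \<and> w * (f * g) \<in> ideal_power I (s + t)" by blast
qed

lemma ideal_power_subset_symbolic_power:
  fixes I :: "'a::idom set"
  assumes "ideal I ring_of_type_algebra"
  shows "ideal_power I s \<subseteq> symbolic_power I s"
proof
  fix f assume "f \<in> ideal_power I s"
  then have "1 * f \<in> ideal_power I s" by simp
  then show "f \<in> symbolic_power I s"
    unfolding mem_symbolic_power_iff[OF assms]
    by (auto simp: associated_primes_def primeideal_type_iff)
qed

section \<open>Monomials of a product\<close>

lemma poly_mapping_eq_sum_single:
  "f = (\<Sum>a\<in>Poly_Mapping.keys f. Poly_Mapping.single a (Poly_Mapping.lookup f a))"
proof (rule poly_mapping_eqI)
  fix k
  have "(\<Sum>a\<in>Poly_Mapping.keys f. Poly_Mapping.lookup f a when a = k) =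
      (\<Sum>a\<in>Poly_Mapping.keys f. if a = k then Poly_Mapping.lookup f a else 0)"
    by (intro sum.cong) (auto simp: when_def)
  then show "Poly_Mapping.lookup f k = Poly_Mapping.lookup
      (\<Sum>a\<in>Poly_Mapping.keys f. Poly_Mapping.single a (Poly_Mapping.lookup f a)) k"
    by (simp add: lookup_sum lookup_single in_keys_iff)
qed

text \<open>The product of the initial forms with respect to \<open>v\<close> is nonzero and is not cancelled by
  the remaining terms.\<close>

lemma ex_minimal_key_add:
  fixes f g :: "('n::linorder \<Rightarrow>\<^sub>0 nat) \<Rightarrow>\<^sub>0 'k::idom"
    and v :: "('n \<Rightarrow>\<^sub>0 nat) \<Rightarrow> 'r::linordered_cancel_ab_semigroup_add"
  assumes add: "\<And>a b. v (a + b) = v a + v b" and "f \<noteq> 0" "g \<noteq> 0"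
  shows "\<exists>a\<in>Poly_Mapping.keys f. \<exists>b\<in>Poly_Mapping.keys g. a + b \<in> Poly_Mapping.keys (f * g) \<and>
    (\<forall>a'\<in>Poly_Mapping.keys f. v a \<le> v a') \<and> (\<forall>b'\<in>Poly_Mapping.keys g. v b \<le> v b')"
proof -
  \<comment> \<open>\<open>ini p\<close> collects all terms of least \<open>v\<close>-value. There
    may be several of them, since \<open>v\<close> need not separate exponents.\<close>
  define ini :: "(('n \<Rightarrow>\<^sub>0 nat) \<Rightarrow>\<^sub>0 'k) \<Rightarrow> ('n \<Rightarrow>\<^sub>0 nat) \<Rightarrow>\<^sub>0 'k" where
    "ini p = Poly_Mapping.mapp (\<lambda>a c. c when v a = Min (v ` Poly_Mapping.keys p)) p" for p
  have keys_ini: "Poly_Mapping.keys (ini p) =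
      {a \<in> Poly_Mapping.keys p. v a = Min (v ` Poly_Mapping.keys p)}" for p
    by (auto simp: in_keys_iff ini_def lookup_mapp when_def split: if_splits)
  have keys_diff: "Poly_Mapping.keys (p - ini p) =
      {a \<in> Poly_Mapping.keys p. v a \<noteq> Min (v ` Poly_Mapping.keys p)}" for p
    by (auto simp: in_keys_iff ini_def lookup_minus lookup_mapp when_def split: if_splits)
  have le: "Min (v ` Poly_Mapping.keys p) \<le> v a" if "a \<in> Poly_Mapping.keys p" for a p
    using that by (intro Min_le) auto
  have lt: "Min (v ` Poly_Mapping.keys p) < v a" if "a \<in> Poly_Mapping.keys (p - ini p)" for a p
    using that le[of a p] unfolding keys_diff by (metis (mono_tags, lifting) mem_Collect_eq le_neq_trans)
  have ini_nz: "ini p \<noteq> 0" if "p \<noteq> 0" for p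
  proof -
    have "Poly_Mapping.keys p \<noteq> {}" using that by simp
    then have "Min (v ` Poly_Mapping.keys p) \<in> v ` Poly_Mapping.keys p"
      by (intro Min_in) auto
    then have "Poly_Mapping.keys (ini p) \<noteq> {}" by (auto simp: keys_ini)
    then show ?thesis by auto
  qed
  let ?m = "Min (v ` Poly_Mapping.keys f)" and ?n = "Min (v ` Poly_Mapping.keys g)"
  let ?r = "ini f * (g - ini g) + (f - ini f) * g"
  have "ini f * ini g \<noteq> 0" using ini_nz assms by simp
  then obtain c where c: "c \<in> Poly_Mapping.keys (ini f * ini g)"
    by (meson ex_in_conv keys_eq_empty)
  then obtain a b where ab: "c = a + b" "a \<in> Poly_Mapping.keys (ini f)" "b \<in> Poly_Mapping.keys (ini g)"
    using keys_mult[of "ini f" "ini g"] by blast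
  have vc: "v c = ?m + ?n" using ab by (simp add: add keys_ini)
  \<comment> \<open>Each product in \<open>?r\<close> has at least one factor without terms of least
    value.\<close>
  have "?m + ?n < v d" if d: "d \<in> Poly_Mapping.keys ?r" for d
  proof -
    consider "d \<in> Poly_Mapping.keys (ini f * (g - ini g))" | "d \<in> Poly_Mapping.keys ((f - ini f) * g)"
      using d keys_add[of "ini f * (g - ini g)" "(f - ini f) * g"] by blast
    then show ?thesis
    proof cases
      case 1
      then obtain a' b' where "d = a' + b'" "a' \<in> Poly_Mapping.keys (ini f)" "b' \<in> Poly_Mapping.keys (g - ini g)"
        using keys_mult[of "ini f" "g - ini g"] by blast
      then show ?thesis
        using lt[of b' g] by (simp add: add keys_ini)
    next
      case 2
      then obtain a' b' where "d = a' + b'" "a' \<in> Poly_Mapping.keys (f - ini f)" "b' \<in> Poly_Mapping.keys g"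
        using keys_mult[of "f - ini f" g] by blast
      then show ?thesis
        using add_less_le_mono[OF lt[of a' f] le[of b' g]] by (simp add: add)
    qed
  qed
  then have "c \<notin> Poly_Mapping.keys ?r" using vc by force
  moreover have "f * g = ini f * ini g + ?r" by (simp add: algebra_simps)
  ultimately have "a + b \<in> Poly_Mapping.keys (f * g)"
    using c ab(1) by (simp add: in_keys_iff lookup_add)
  moreover have "a \<in> Poly_Mapping.keys f" "v a = ?m" "b \<in> Poly_Mapping.keys g" "v b = ?n"
    using ab by (auto simp: keys_ini)
  ultimately show ?thesis using le by metis
qed

section \<open>Monomial ideals and monomial primes\<close>

lemma keys_monomial [simp]: "Poly_Mapping.keys (monomial a :: ('n, 'k::field) mpoly) = {a}"
  by (simp add: monomial_def)

text \<open>Exponents of a sum occur in a summand and those of a product are sums of exponents, so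
  upward closure of \<open>U\<close> suffices. The ideals below that are cut out by a condition on
  exponents are recognized this way.\<close>

lemma ideal_exponent_set:
  assumes "\<And>a b. U a \<Longrightarrow> U (a + b)"
  shows "ideal {f :: ('n, 'k::field) mpoly. \<forall>a\<in>Poly_Mapping.keys f. U a} ring_of_type_algebra"
  unfolding ideal_type_iff
proof (intro conjI ballI allI; clarsimp)
  fix f g :: "('n, 'k) mpoly" and a
  assume "\<forall>a\<in>Poly_Mapping.keys f. U a" "\<forall>a\<in>Poly_Mapping.keys g. U a" "a \<in> Poly_Mapping.keys (f + g)"
  then show "U a" using keys_add[of f g] by blast
next
  fix f g :: "('n, 'k) mpoly" and a
  assume f: "\<forall>a\<in>Poly_Mapping.keys f. U a" and "a \<in> Poly_Mapping.keys (g * f)"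
  then obtain b c where "a = b + c" "c \<in> Poly_Mapping.keys f"
    using keys_mult[of g f] by blast
  then show "U a" using f assms[of c b] by (simp add: add.commute)
qed

text \<open>The right-hand side defines an ideal containing the generators; conversely, each term of
  such an \<open>f\<close> is a multiple of a generator.\<close>

lemma mem_Idl_monomial_iff:
  fixes f :: "('n, 'k::field) mpoly"
  shows "f \<in> Idl\<^bsub>ring_of_type_algebra\<^esub> (monomial ` A) \<longleftrightarrow>
    (\<forall>a\<in>Poly_Mapping.keys f. \<exists>b\<in>A. \<forall>i. Poly_Mapping.lookup b i \<le> Poly_Mapping.lookup a i)"
    (is "f \<in> ?I \<longleftrightarrow> (\<forall>a\<in>Poly_Mapping.keys f. ?U a)")
proof
  have "ideal {f :: ('n, 'k) mpoly. \<forall>a\<in>Poly_Mapping.keys f. ?U a} ring_of_type_algebra"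
    by (rule ideal_exponent_set) (auto simp: lookup_add intro: trans_le_add1)
  then have "?I \<subseteq> {f :: ('n, 'k) mpoly. \<forall>a\<in>Poly_Mapping.keys f. ?U a}"
    by (rule genideal_type(3)) auto
  then show "f \<in> ?I \<Longrightarrow> \<forall>a\<in>Poly_Mapping.keys f. ?U a" by blast
next
  assume U: "\<forall>a\<in>Poly_Mapping.keys f. ?U a"
  have I: "ideal ?I (ring_of_type_algebra :: ('n, 'k) mpoly ring)" by (rule genideal_type(1))
  have "Poly_Mapping.single a (Poly_Mapping.lookup f a) \<in> ?I" if a: "a \<in> Poly_Mapping.keys f" for a
  proof -
    obtain b where b: "b \<in> A" "\<And>i. Poly_Mapping.lookup b i \<le> Poly_Mapping.lookup a i"
      using bspec[OF U a] by auto
    \<comment> \<open>The truncated subtraction is exact because \<open>b\<close> lies below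
      \<open>a\<close> in every coordinate.\<close>
    have "a = (a - b) + b"
      by (rule poly_mapping_eqI) (simp add: lookup_add lookup_minus b(2))
    then have "Poly_Mapping.single a (Poly_Mapping.lookup f a) =
        Poly_Mapping.single (a - b) (Poly_Mapping.lookup f a) * monomial b"
      by (simp add: monomial_def mult_single)
    moreover have "monomial b \<in> ?I" using b(1) genideal_type(2) by blast
    ultimately show ?thesis using I by (simp add: ideal_type_iff)
  qed
  then have "(\<Sum>a\<in>Poly_Mapping.keys f. Poly_Mapping.single a (Poly_Mapping.lookup f a)) \<in> ?I"
    by (rule ideal_type_sum[OF I])
  then show "f \<in> ?I" by (simp add: poly_mapping_eq_sum_single[symmetric])
qed

section \<open>Weighted orders, and primes generated by variables\<close>

text \<open>The weights are chosen so that, for positive \<open>w j\<close>, the power of the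
  variable \<open>j\<close> with exponent \<open>w j\<close> has value 1 when \<open>j\<close> lies
  in \<open>C\<close>.\<close>

definition weighted_order :: "('n \<Rightarrow> nat) \<Rightarrow> 'n set \<Rightarrow> ('n \<Rightarrow>\<^sub>0 nat) \<Rightarrow> real" where
  "weighted_order w C a = (\<Sum>j\<in>C. real (Poly_Mapping.lookup a j) / real (w j))"

lemma weighted_order_add: "weighted_order w C (a + b) = weighted_order w C a + weighted_order w C b"
  by (simp add: weighted_order_def lookup_add add_divide_distrib sum.distrib)

lemma weighted_order_nonneg: "weighted_order w C a \<ge> 0"
  by (simp add: weighted_order_def sum_nonneg)

lemma weighted_order_eq_0_iff:
  fixes C :: "'n::finite set"
  assumes "\<And>i. w i > 0"
  shows "weighted_order w C a = 0 \<longleftrightarrow> (\<forall>j\<in>C. Poly_Mapping.lookup a j = 0)"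
  using assms by (simp add: weighted_order_def sum_nonneg_eq_0_iff less_imp_neq[symmetric])

text \<open>This is the ideal generated by the variables in \<open>C\<close>, given by exponents so
  that membership can be read off term by term; the empty \<open>C\<close> gives the zero
  ideal.\<close>

definition variable_prime :: "'n set \<Rightarrow> ('n, 'k::field) mpoly set" where
  "variable_prime C = {f. \<forall>a\<in>Poly_Mapping.keys f. \<exists>j\<in>C. Poly_Mapping.lookup a j \<noteq> 0}"

text \<open>A polynomial outside the ideal has a term of order 0. If both factors are outside, the
  sum of suitable minimal exponents survives in the product and again has order 0.\<close>

lemma primeideal_variable_prime:
  "primeideal (variable_prime C :: ('n::{finite,linorder}, 'k::field) mpoly set) ring_of_type_algebra"
  unfolding primeideal_type_iff
proof (intro conjI allI impI)
  show "ideal (variable_prime C :: ('n, 'k) mpoly set) ring_of_type_algebra"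
    unfolding variable_prime_def by (rule ideal_exponent_set) (auto simp: lookup_add)
  show "1 \<notin> (variable_prime C :: ('n, 'k) mpoly set)"
    by (simp add: variable_prime_def)
  fix f g :: "('n, 'k) mpoly"
  assume fg: "f * g \<in> variable_prime C"
  show "f \<in> variable_prime C \<or> g \<in> variable_prime C"
  proof (rule ccontr)
    assume neg: "\<not> ?thesis"
    let ?v = "weighted_order (\<lambda>_. 1) C"
    have *: "?v a = 0 \<longleftrightarrow> (\<forall>j\<in>C. Poly_Mapping.lookup a j = 0)" for a
      by (rule weighted_order_eq_0_iff) simp
    obtain a0 b0 where a0: "a0 \<in> Poly_Mapping.keys f" "?v a0 = 0" and b0: "b0 \<in> Poly_Mapping.keys g" "?v b0 = 0"
      using neg unfolding variable_prime_def * by blast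
    then have "f \<noteq> 0" "g \<noteq> 0" by auto
    then obtain a b where ab: "a + b \<in> Poly_Mapping.keys (f * g)" "?v a \<le> ?v a0" "?v b \<le> ?v b0"
      using ex_minimal_key_add[of ?v f g, OF weighted_order_add] a0 b0 by blast
    then have "?v (a + b) = 0"
      using a0 b0 weighted_order_nonneg[of "\<lambda>_. 1" C a] weighted_order_nonneg[of "\<lambda>_. 1" C b]
      by (simp add: weighted_order_add)
    then have "\<forall>j\<in>C. Poly_Mapping.lookup (a + b) j = 0" unfolding * .
    moreover obtain j where "j \<in> C" "Poly_Mapping.lookup (a + b) j \<noteq> 0"
      using fg ab(1) by (auto simp: variable_prime_def)
    ultimately show False by simp
  qed
qed

text \<open>Adjoining the variables of \<open>C\<close> one at a time gives a strict chain of primes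
  starting at the zero ideal. Big-height thereby bounds the size of minimal transversals.\<close>

lemma card_le_height_variable_prime:
  fixes C :: "'n::{finite,linorder} set"
  shows "enat (card C) \<le> height ring_of_type_algebra (variable_prime C :: ('n, 'k::field) mpoly set)"
proof -
  obtain e where e: "bij_betw e {0..<card C} C"
    using ex_bij_betw_nat_finite[of C] by auto
  define c :: "nat \<Rightarrow> ('n, 'k) mpoly set" where "c i = variable_prime (e ` {0..<i})" for i
  have "c i \<subset> c (Suc i)" if "i < card C" for i
  proof -
    let ?x = "monomial (Poly_Mapping.single (e i) 1) :: ('n, 'k) mpoly"
    have "e i \<noteq> e k" if "k < i" for k
      using that \<open>i < card C\<close> inj_onD[OF bij_betw_imp_inj_on[OF e], of i k] by auto
    then have "?x \<in> c (Suc i)" "?x \<notin> c i"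
      by (auto simp: c_def variable_prime_def lookup_single when_def)
    moreover have "c i \<subseteq> c (Suc i)"
      unfolding c_def variable_prime_def
      by (auto, meson atLeastLessThan_iff less_SucI)
    ultimately show ?thesis by blast
  qed
  moreover have "\<forall>i\<le>card C. primeideal (c i) ring_of_type_algebra"
    unfolding c_def by (intro allI impI primeideal_variable_prime)
  moreover have "c (card C) = variable_prime C"
    using e by (simp add: c_def bij_betw_def)
  ultimately show ?thesis
    unfolding height_def by (intro Sup_upper) blast
qed

section \<open>Transversals and fractional covers\<close>

definition transversal :: "'n set set \<Rightarrow> 'n set \<Rightarrow> bool" where
  "transversal \<S> T \<longleftrightarrow> (\<forall>S\<in>\<S>. S \<inter> T \<noteq> {})"

text \<open>Testing single deletions captures inclusion-minimality, since supersets of transversals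
  are transversals.\<close>

definition minimal_transversal :: "'n set set \<Rightarrow> 'n set \<Rightarrow> bool" where
  "minimal_transversal \<S> T \<longleftrightarrow> transversal \<S> T \<and> (\<forall>t\<in>T. \<not> transversal \<S> (T - {t}))"

lemma ex_minimal_transversal_subset:
  assumes "finite D" "transversal \<S> D"
  shows "\<exists>T\<subseteq>D. minimal_transversal \<S> T"
  using assms
proof (induction D rule: finite_psubset_induct)
  case (psubset D)
  show ?case
  proof (cases "minimal_transversal \<S> D")
    case False
    then obtain t where "t \<in> D" "transversal \<S> (D - {t})"
      using psubset.prems by (auto simp: minimal_transversal_def)
    then show ?thesis using psubset.IH[of "D - {t}"] by blast
  qed auto
qed

text \<open>Deleting \<open>t\<close> leaves some edge unhit, and that edge can meet
  \<open>T\<close> only in \<open>t\<close>.\<close>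

lemma minimal_transversal_private:
  assumes "minimal_transversal \<S> T" "t \<in> T"
  shows "\<exists>S\<in>\<S>. S \<inter> T = {t}"
proof -
  obtain S where "S \<in> \<S>" "S \<inter> (T - {t}) = {}" "S \<inter> T \<noteq> {}"
    using assms unfolding minimal_transversal_def transversal_def by meson
  then show ?thesis by blast
qed

text \<open>This is blocker duality: if \<open>T\<close> contains no edge, its complement hits every
  edge and so contains a minimal transversal that misses \<open>T\<close>.\<close>

lemma transversal_minimal_transversals_iff:
  fixes \<S> :: "'n::finite set set"
  shows "transversal {C. minimal_transversal \<S> C} T \<longleftrightarrow> (\<exists>S\<in>\<S>. S \<subseteq> T)"
proof
  assume T: "transversal {C. minimal_transversal \<S> C} T"
  show "\<exists>S\<in>\<S>. S \<subseteq> T"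
  proof (rule ccontr)
    assume "\<not> ?thesis"
    then have "transversal \<S> (- T)" by (auto simp: transversal_def)
    then obtain C where "C \<subseteq> - T" "minimal_transversal \<S> C"
      using ex_minimal_transversal_subset[of "- T" \<S>] by auto
    then show False using T by (auto simp: transversal_def)
  qed
qed (fastforce simp: transversal_def minimal_transversal_def)

text \<open>The elements of weight at least \<open>1/h\<close> form a cover. In a minimal cover \<open>T\<close> inside it, some
  \<open>t\<close> has a private edge \<open>C\<close>: \<open>C\<close> carries total weight at least \<open>1\<close> instead of the \<open>1/h\<close>
  known for \<open>t\<close> alone, which produces the summand \<open>h - 1\<close>.\<close>

lemma fractional_cover_bound:
  fixes y w :: "'n::finite \<Rightarrow> real"
  assumes ne: "\<C> \<noteq> {}" and card: "\<And>C. C \<in> \<C> \<Longrightarrow> card C \<le> h"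
    and y: "\<And>i. y i \<ge> 0" and w: "\<And>i. w i \<ge> 1"
    and cover: "\<And>C. C \<in> \<C> \<Longrightarrow> sum y C \<ge> 1"
    and M: "\<And>T. transversal \<C> T \<Longrightarrow> M \<le> sum w T"
  shows "(M + real h - 1) / real h \<le> (\<Sum>i\<in>UNIV. w i * y i)"
proof -
  \<comment> \<open>For \<open>h = 0\<close> every edge would be empty, and an empty edge cannot
    carry total weight 1.\<close>
  have h: "h > 0"
  proof (rule ccontr)
    assume "\<not> h > 0"
    moreover obtain C where "C \<in> \<C>" using ne by blast
    ultimately show False using card[of C] cover[of C] by simp
  qed
  \<comment> \<open>Averaging: at most \<open>h\<close> values with sum at least 1 cannot all be
    below \<open>1 / h\<close>.\<close>
  have "transversal \<C> {j. y j \<ge> 1 / h}"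
    unfolding transversal_def
  proof
    fix C assume C: "C \<in> \<C>"
    show "C \<inter> {j. y j \<ge> 1 / h} \<noteq> {}"
    proof
      assume "C \<inter> {j. y j \<ge> 1 / h} = {}"
      then have lt: "y j < 1 / h" if "j \<in> C" for j using that by force
      have "C \<noteq> {}" using cover[OF C] by auto
      then have "sum y C < (\<Sum>j\<in>C. 1 / real h)" by (intro sum_strict_mono lt) auto
      also have "\<dots> \<le> 1" using card[OF C] h by (simp add: divide_simps)
      finally show False using cover[OF C] by simp
    qed
  qed
  then obtain T where T: "minimal_transversal \<C> T" and yT: "\<And>j. j \<in> T \<Longrightarrow> y j \<ge> 1 / h"
    using ex_minimal_transversal_subset[of "{j. y j \<ge> 1 / h}" \<C>] by auto
  have trans: "transversal \<C> T" using T by (simp add: minimal_transversal_def)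
  then obtain t where t: "t \<in> T" using ne by (auto simp: transversal_def)
  obtain C where C: "C \<in> \<C>" "C \<inter> T = {t}"
    using minimal_transversal_private[OF T t] by blast
  have wy: "w i * y i \<ge> y i" for i using mult_right_mono[OF w[of i] y[of i]] by simp
  have "(w t - 1) / h \<le> (w t - 1) * y t"
    using mult_left_mono[OF yT[OF t], of "w t - 1"] w[of t] by simp
  moreover have "sum w (T - {t}) / h \<le> (\<Sum>i\<in>T - {t}. w i * y i)"
    unfolding sum_divide_distrib
  proof (rule sum_mono)
    fix i assume "i \<in> T - {t}"
    then show "w i / h \<le> w i * y i"
      using mult_left_mono[OF yT[of i], of "w i"] w[of i] by simp
  qed
  \<comment> \<open>Split \<open>w t * y t\<close> into \<open>y t\<close> and the excess
    \<open>(w t - 1) * y t\<close>: the first part joins the cover sum of the private edge, the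
    second is kept on top of it.\<close>
  moreover have "1 + (w t - 1) * y t \<le> (\<Sum>i\<in>C. w i * y i)"
  proof -
    have tC: "t \<in> C" using C by blast
    have "sum y (C - {t}) \<le> (\<Sum>i\<in>C - {t}. w i * y i)" by (intro sum_mono wy)
    then show ?thesis
      using cover[OF C(1)] tC by (simp add: sum.remove[of C t] algebra_simps)
  qed
  \<comment> \<open>The private edge \<open>C\<close> meets \<open>T\<close> only in
    \<open>t\<close>, so the two index sets are disjoint and nothing is counted twice.\<close>
  moreover have "(\<Sum>i\<in>T - {t}. w i * y i) + (\<Sum>i\<in>C. w i * y i) \<le> (\<Sum>i\<in>UNIV. w i * y i)"
  proof -
    have "(\<Sum>i\<in>T - {t}. w i * y i) + (\<Sum>i\<in>C. w i * y i) = (\<Sum>i\<in>(T - {t}) \<union> C. w i * y i)"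
      using C by (subst sum.union_disjoint) auto
    also have "\<dots> \<le> (\<Sum>i\<in>UNIV. w i * y i)"
      using order_trans[OF y wy] by (intro sum_mono2) auto
    finally show ?thesis .
  qed
  moreover have "(M + real h - 1) / h \<le> sum w (T - {t}) / h + (1 + (w t - 1) / h)"
    using M[OF trans] t h by (simp add: sum.remove[of T t] field_simps)
  ultimately show ?thesis by linarith
qed

section \<open>Subadditive sequences\<close>

lemma subadditive_mult_add_le:
  fixes a :: "nat \<Rightarrow> real"
  assumes "\<And>m n. a (m + n) \<le> a m + a n"
  shows "a (q * m + r) \<le> real q * a m + a r"
proof (induction q)
  case (Suc q)
  then show ?case using assms[of m "q * m + r"] by (simp add: algebra_simps)
qed simp

text \<open>Fekete's lemma: the limit is the infimum \<open>L\<close> of the quotients. Choose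
  \<open>m\<close> with quotient close to \<open>L\<close> and divide \<open>n\<close> by
  \<open>m\<close> with remainder.\<close>

lemma subadditive_quotient_convergent:
  fixes a :: "nat \<Rightarrow> real"
  assumes sub: "\<And>m n. a (m + n) \<le> a m + a n" and nonneg: "\<And>n. a n \<ge> 0"
  shows "convergent (\<lambda>n. a n / real n)"
proof -
  define L where "L = (INF n\<in>{1..}. a n / real n)"
  have bdd: "bdd_below ((\<lambda>n. a n / real n) ` {1..})"
    using nonneg by (intro bdd_belowI2[of _ 0]) simp
  have "(\<lambda>n. a n / real n) \<longlonglongrightarrow> L"
  proof (rule LIMSEQ_I)
    fix \<epsilon> :: real assume "\<epsilon> > 0"
    then obtain m where m: "m \<ge> 1" "a m / real m < L + \<epsilon> / 2"
      using cINF_less_iff[OF _ bdd, of "L + \<epsilon> / 2"] by (auto simp: L_def)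
    \<comment> \<open>\<open>B\<close> bounds the value at every remainder at once, so its
      contribution \<open>B / n\<close> vanishes in the limit.\<close>
    define B where "B = (\<Sum>r<m. a r)"
    have B: "a r \<le> B" if "r < m" for r
      unfolding B_def using that nonneg by (intro member_le_sum) auto
    obtain N where N: "real N > 2 * B / \<epsilon>" using reals_Archimedean2 by blast
    have "norm (a n / real n - L) < \<epsilon>" if n: "n \<ge> max 1 N" for n
    proof -
      have n0: "real n > 0" and nN: "real n > 2 * B / \<epsilon>" using n N by auto
      have "a n \<le> real (n div m) * a m + a (n mod m)"
        using subadditive_mult_add_le[of a "n div m" m "n mod m", OF sub] by simp
      also have "\<dots> \<le> real (n div m) * a m + B"
        using B[of "n mod m"] m by simp
      also have "real (n div m) * a m = real (n div m * m) * (a m / real m)"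
        using m by simp
      also have "real (n div m * m) * (a m / real m) \<le> real n * (a m / real m)"
        using nonneg[of m] by (intro mult_right_mono of_nat_mono) auto
      finally have "a n / real n \<le> a m / real m + B / real n"
        using n0 by (simp add: field_simps)
      moreover have "B / real n < \<epsilon> / 2"
        using nN n0 \<open>\<epsilon> > 0\<close> by (simp add: field_simps)
      moreover have "L \<le> a n / real n"
        unfolding L_def using n by (intro cINF_lower[OF bdd]) simp
      ultimately show ?thesis using m(2) unfolding real_norm_def by linarith
    qed
    then show "\<exists>N. \<forall>n\<ge>N. norm (a n / real n - L) < \<epsilon>" by blast
  qed
  then show ?thesis by (rule convergentI)
qed

section \<open>Weighted squarefree monomial ideals\<close>

text \<open>The members of \<open>\<S>\<close> are the supports of the generators of the squarefree ideal.\<close>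

definition weighted_support_ideal :: "('n \<Rightarrow> nat) \<Rightarrow> 'n set set \<Rightarrow> ('n, 'k::field) mpoly set" where
  "weighted_support_ideal w \<S> =
    {f. \<forall>a\<in>Poly_Mapping.keys f. \<exists>S\<in>\<S>. \<forall>i\<in>S. w i \<le> Poly_Mapping.lookup a i}"

lemma ideal_weighted_support_ideal:
  "ideal (weighted_support_ideal w \<S> :: ('n, 'k::field) mpoly set) ring_of_type_algebra"
  unfolding weighted_support_ideal_def
  by (rule ideal_exponent_set) (force simp: lookup_add intro: trans_le_add1)

text \<open>A monomial of \<open>J\<close> lies above a squarefree generator, and weighting
  preserves this. The weighted generator has exponent \<open>w i\<close> on its support and 0
  elsewhere, so only supports and weights remain.\<close>

lemma standard_linear_weighting_obtains:
  fixes I :: "('n, 'k::field) mpoly set"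
  assumes "has_standard_linear_weighting I"
  obtains w \<S> where "\<And>i. w i > 0" "I = weighted_support_ideal w \<S>"
proof -
  obtain J :: "('n, 'k) mpoly set" and w A
    where w: "\<And>i. w i > 0" and I: "I = weighted_monomial_ideal w J"
      and sqfree: "\<And>a i. a \<in> A \<Longrightarrow> Poly_Mapping.lookup a i \<le> 1"
      and J: "J = Idl\<^bsub>ring_of_type_algebra\<^esub> (monomial ` A)"
    using assms unfolding has_standard_linear_weighting_def squarefree_monomial_ideal_def
      standard_linear_weighting_def by blast
  let ?W = "weight_exponent w ` {a. monomial a \<in> J}"
  have IW: "I = Idl\<^bsub>ring_of_type_algebra\<^esub> (monomial ` ?W)"
    unfolding I weighted_monomial_ideal_def by (rule arg_cong[of _ _ "genideal _"]) blast
  have memJ: "monomial a \<in> J \<longleftrightarrow> (\<exists>b\<in>A. \<forall>i. Poly_Mapping.lookup b i \<le> Poly_Mapping.lookup a i)" for a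
    by (simp add: J mem_Idl_monomial_iff)
  have "(\<exists>b\<in>?W. \<forall>i. Poly_Mapping.lookup b i \<le> Poly_Mapping.lookup a i) \<longleftrightarrow>
      (\<exists>S\<in>Poly_Mapping.keys ` A. \<forall>i\<in>S. w i \<le> Poly_Mapping.lookup a i)" (is "?l \<longleftrightarrow> ?r") for a
  proof
    assume ?l
    then obtain c b where cb: "b \<in> A" "\<And>i. Poly_Mapping.lookup b i \<le> Poly_Mapping.lookup c i"
        "\<And>i. w i * Poly_Mapping.lookup c i \<le> Poly_Mapping.lookup a i"
      by (auto simp: memJ)
    have "w i \<le> Poly_Mapping.lookup a i" if "i \<in> Poly_Mapping.keys b" for i
    proof -
      have "1 \<le> Poly_Mapping.lookup c i"
        using that cb(2)[of i] by (simp add: in_keys_iff)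
      then have "w i * 1 \<le> w i * Poly_Mapping.lookup c i" by (rule mult_le_mono2)
      from order_trans[OF this cb(3)] show ?thesis by simp
    qed
    then show ?r using cb(1) by blast
  next
    assume ?r
    then obtain b where b: "b \<in> A" "\<And>i. i \<in> Poly_Mapping.keys b \<Longrightarrow> w i \<le> Poly_Mapping.lookup a i"
      by blast
    have "w i * Poly_Mapping.lookup b i \<le> Poly_Mapping.lookup a i" for i
    proof (cases "i \<in> Poly_Mapping.keys b")
      case True
      then show ?thesis
        using order_trans[OF mult_le_mono2[OF sqfree[OF b(1), of i], of "w i"], of "Poly_Mapping.lookup a i"] b(2)[of i]
        by simp
    next
      case False
      then show ?thesis by (simp add: in_keys_iff)
    qed
    \<comment> \<open>The generator itself serves as the monomial of \<open>J\<close> to be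
      weighted.\<close>
    moreover have "monomial b \<in> J" using b(1) memJ by blast
    ultimately show ?l by (auto intro!: exI[of _ b])
  qed
  then have "I = weighted_support_ideal w (Poly_Mapping.keys ` A)"
    by (auto simp: weighted_support_ideal_def IW mem_Idl_monomial_iff simp del: bex_simps ball_simps)
  then show ?thesis using that w by blast
qed

text \<open>The colon of the ideal by the monomial with exponents \<open>w j\<close> off \<open>C\<close> and \<open>w j - 1\<close> on \<open>C\<close>
  is the prime generated by the variables in \<open>C\<close>.\<close>

lemma variable_prime_associated:
  fixes \<S> :: "'n::{finite,linorder} set set"
  assumes w: "\<And>i. w i > 0" and C: "minimal_transversal \<S> C"
  shows "(variable_prime C :: ('n, 'k::field) mpoly set) \<in>
    associated_primes ring_of_type_algebra (weighted_support_ideal w \<S>)"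
proof -
  define m :: "'n \<Rightarrow>\<^sub>0 nat" where "m = Abs_poly_mapping (\<lambda>j. if j \<in> C then w j - 1 else w j)"
  have m: "Poly_Mapping.lookup m j = (if j \<in> C then w j - 1 else w j)" for j
    by (simp add: m_def)
  \<comment> \<open>Every edge meets \<open>C\<close>, where \<open>m\<close> falls short by one, so
    some variable of \<open>C\<close> must be added. One variable \<open>j\<close> of
    \<open>C\<close> suffices, because a private edge of \<open>j\<close> has no other
    deficit.\<close>
  have shift: "(\<exists>S\<in>\<S>. \<forall>i\<in>S. w i \<le> Poly_Mapping.lookup (a + m) i) \<longleftrightarrow>
      (\<exists>j\<in>C. Poly_Mapping.lookup a j \<noteq> 0)" for a
  proof
    assume "\<exists>S\<in>\<S>. \<forall>i\<in>S. w i \<le> Poly_Mapping.lookup (a + m) i"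
    then obtain S where S: "S \<in> \<S>" "\<And>i. i \<in> S \<Longrightarrow> w i \<le> Poly_Mapping.lookup (a + m) i" by blast
    have "S \<inter> C \<noteq> {}"
      using S(1) C by (simp add: minimal_transversal_def transversal_def)
    then obtain j where j: "j \<in> S" "j \<in> C" by blast
    then have "Poly_Mapping.lookup a j \<noteq> 0"
      using S(2)[of j] w[of j] by (auto simp: lookup_add m)
    then show "\<exists>j\<in>C. Poly_Mapping.lookup a j \<noteq> 0" using j by blast
  next
    assume "\<exists>j\<in>C. Poly_Mapping.lookup a j \<noteq> 0"
    then obtain j where j: "j \<in> C" "Poly_Mapping.lookup a j \<noteq> 0" by blast
    obtain S where S: "S \<in> \<S>" "S \<inter> C = {j}" using minimal_transversal_private[OF C j(1)] by blast
    have "w i \<le> Poly_Mapping.lookup (a + m) i" if "i \<in> S" for i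
      using that S(2) j by (cases "i = j") (auto simp: lookup_add m)
    then show "\<exists>S\<in>\<S>. \<forall>i\<in>S. w i \<le> Poly_Mapping.lookup (a + m) i" using S(1) by blast
  qed
  \<comment> \<open>Multiplication by a monomial translates exponents injectively, so no terms
    cancel.\<close>
  have keys: "Poly_Mapping.keys (g * monomial m) = (\<lambda>a. a + m) ` Poly_Mapping.keys g"
    for g :: "('n, 'k) mpoly"
  proof
    show "Poly_Mapping.keys (g * monomial m) \<subseteq> (\<lambda>a. a + m) ` Poly_Mapping.keys g"
      using keys_mult[of g "monomial m"] by auto
    have "Poly_Mapping.lookup (g * monomial m) (a + m) = Poly_Mapping.lookup g a" for a
    proof -
      have "g * monomial m = (\<Sum>b\<in>Poly_Mapping.keys g.
          Poly_Mapping.single (b + m) (Poly_Mapping.lookup g b))"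
        by (subst poly_mapping_eq_sum_single[of g])
          (simp add: sum_distrib_right monomial_def mult_single)
      then have "Poly_Mapping.lookup (g * monomial m) (a + m) =
          (\<Sum>b\<in>Poly_Mapping.keys g. Poly_Mapping.lookup (Poly_Mapping.single b (Poly_Mapping.lookup g b)) a)"
        by (simp add: lookup_sum lookup_single)
      also have "\<dots> = Poly_Mapping.lookup g a"
        by (subst (3) poly_mapping_eq_sum_single[of g]) (simp add: lookup_sum)
      finally show ?thesis .
    qed
    then show "(\<lambda>a. a + m) ` Poly_Mapping.keys g \<subseteq> Poly_Mapping.keys (g * monomial m)"
      by (auto simp: in_keys_iff)
  qed
  have "variable_prime C = {g :: ('n, 'k) mpoly. g * monomial m \<in> weighted_support_ideal w \<S>}"
    by (simp add: variable_prime_def weighted_support_ideal_def keys shift)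
  then show ?thesis
    unfolding associated_primes_def mem_Collect_eq
    by (intro conjI bexI[of _ "monomial m"] primeideal_variable_prime) simp_all
qed

section \<open>Weighted orders on ordinary and symbolic powers\<close>

text \<open>An exponent in the ideal reaches \<open>w j\<close> at some \<open>j\<close> in
  \<open>C\<close>, which contributes at least 1. Additivity of the order carries this through
  products, and sums create no new exponents.\<close>

lemma ideal_power_weighted_order:
  fixes f :: "('n::finite, 'k::field) mpoly"
  assumes w: "\<And>i. w i > 0" and C: "transversal \<S> C"
    and "f \<in> ideal_power (weighted_support_ideal w \<S>) s" "a \<in> Poly_Mapping.keys f"
  shows "real s \<le> weighted_order w C a"
  using assms(3,4)
proof (induction s arbitrary: f a)
  case 0
  then show ?case by (simp add: weighted_order_nonneg)
next
  case (Suc s)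
  let ?I = "weighted_support_ideal w \<S> :: ('n, 'k) mpoly set"
  have one: "1 \<le> weighted_order w C b" if g: "g \<in> ?I" "b \<in> Poly_Mapping.keys g" for g b
  proof -
    obtain S where S: "S \<in> \<S>" "\<And>i. i \<in> S \<Longrightarrow> w i \<le> Poly_Mapping.lookup b i"
      using g unfolding weighted_support_ideal_def by blast
    then obtain j where j: "j \<in> S" "j \<in> C" using C by (auto simp: transversal_def)
    have "1 \<le> real (Poly_Mapping.lookup b j) / real (w j)"
      using S(2)[OF j(1)] w[of j] by simp
    also have "\<dots> \<le> weighted_order w C b"
      unfolding weighted_order_def using j(2) by (intro member_le_sum) auto
    finally show ?thesis .
  qed
  from Suc.prems(1) have "f \<in> ideal_prod ring_of_type_algebra (ideal_power ?I s) ?I"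
    by (simp only: ideal_power_Suc)
  then show ?case using Suc.prems(2)
  proof (induction f arbitrary: a rule: ideal_prod.induct)
    case (prod f g)
    then obtain b c where "a = b + c" "b \<in> Poly_Mapping.keys f" "c \<in> Poly_Mapping.keys g"
      using keys_mult[of f g] by auto
    then show ?case
      using Suc.IH[OF prod.hyps(1), of b] one[OF prod.hyps(2), of c] by (simp add: weighted_order_add)
  next
    case (sum f g)
    then show ?case using keys_add[of f g] by auto
  qed
qed

text \<open>A multiplier outside the associated prime has least order 0, so multiplying by it leaves
  the least order of \<open>f\<close> unchanged and the bound for ordinary powers descends to
  \<open>f\<close>.\<close>

lemma symbolic_power_weighted_order:
  fixes f :: "('n::{finite,linorder}, 'k::field) mpoly"
  assumes w: "\<And>i. w i > 0" and C: "minimal_transversal \<S> C"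
    and f: "f \<in> symbolic_power (weighted_support_ideal w \<S>) s" and a: "a \<in> Poly_Mapping.keys f"
  shows "real s \<le> weighted_order w C a"
proof -
  let ?v = "weighted_order w C"
  obtain u :: "('n, 'k) mpoly" where u: "u \<notin> variable_prime C"
    and uf: "u * f \<in> ideal_power (weighted_support_ideal w \<S>) s"
    using f variable_prime_associated[of w \<S> C, OF w C]
    by (auto simp: mem_symbolic_power_iff[OF ideal_weighted_support_ideal])
  obtain b0 where b0: "b0 \<in> Poly_Mapping.keys u" "?v b0 = 0"
    using u by (auto simp: variable_prime_def weighted_order_eq_0_iff[of w, OF w])
  have "u \<noteq> 0" "f \<noteq> 0" using b0 a by auto
  then obtain b c where bc: "b + c \<in> Poly_Mapping.keys (u * f)" "?v b \<le> ?v b0" "?v c \<le> ?v a"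
    using ex_minimal_key_add[of ?v u f, OF weighted_order_add] b0 a by blast
  have "real s \<le> ?v (b + c)"
    using ideal_power_weighted_order[OF w _ uf bc(1), of C] C by (simp add: minimal_transversal_def)
  then show ?thesis using bc b0 by (simp add: weighted_order_add)
qed

section \<open>Initial degrees\<close>

lemma homogeneous_mult:
  assumes "homogeneous d f" "homogeneous e g"
  shows "homogeneous (d + e) (f * g)"
  unfolding homogeneous_def
proof
  fix a assume "a \<in> Poly_Mapping.keys (f * g)"
  then obtain b c where "a = b + c" "b \<in> Poly_Mapping.keys f" "c \<in> Poly_Mapping.keys g"
    using keys_mult[of f g] by auto
  then show "total_degree a = d + e"
    using assms by (simp add: homogeneous_def total_degree_def lookup_add sum.distrib)
qed

lemma initial_degree_le:
  assumes "f \<in> L" "f \<noteq> 0" "homogeneous d f"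
  shows "initial_degree L \<le> d"
  unfolding initial_degree_def using assms by (intro Least_le) blast

lemma initial_degree_attained:
  assumes "f \<in> L" "f \<noteq> 0" "homogeneous d f"
  shows "\<exists>g\<in>L. g \<noteq> 0 \<and> homogeneous (initial_degree L) g"
  unfolding initial_degree_def
  by (rule LeastI[of "\<lambda>d. \<exists>g\<in>L. g \<noteq> 0 \<and> homogeneous d g"]) (use assms in blast)

text \<open>Powers of one monomial of \<open>I\<close> are nonzero homogeneous elements of the
  symbolic powers, which makes the \<open>LEAST\<close> in the initial degree meaningful.\<close>

lemma symbolic_power_initial_degree_attained:
  fixes I :: "('n::{finite,linorder}, 'k::field) mpoly set"
  assumes I: "ideal I ring_of_type_algebra" and a: "monomial a \<in> I"
  shows "\<exists>f\<in>symbolic_power I s. f \<noteq> 0 \<and> homogeneous (initial_degree (symbolic_power I s)) f"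
proof -
  have hom: "homogeneous (s * total_degree a) (monomial a ^ s :: ('n, 'k) mpoly)"
  proof (induction s)
    case 0
    then show ?case by (simp add: homogeneous_def total_degree_def)
  next
    case (Suc s)
    then show ?case
      using homogeneous_mult[OF _ Suc, of "total_degree a" "monomial a"] by (simp add: homogeneous_def)
  qed
  have "(monomial a :: ('n, 'k) mpoly) \<noteq> 0"
    by (metis keys_monomial keys_zero insert_not_empty)
  then have "(monomial a ^ s :: ('n, 'k) mpoly) \<noteq> 0" by simp
  moreover have "monomial a ^ s \<in> symbolic_power I s"
    using power_mem_ideal_power[OF a] ideal_power_subset_symbolic_power[OF I] by blast
  ultimately show ?thesis using initial_degree_attained hom by blast
qed

lemma convergent_initial_degree_symbolic_power:
  fixes I :: "('n::{finite,linorder}, 'k::field) mpoly set"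
  assumes I: "ideal I ring_of_type_algebra" and a: "monomial a \<in> I"
  shows "convergent (\<lambda>s. real (initial_degree (symbolic_power I s)) / real s)"
proof (rule subadditive_quotient_convergent)
  fix s t
  obtain f where f: "f \<in> symbolic_power I s" "f \<noteq> 0" "homogeneous (initial_degree (symbolic_power I s)) f"
    using symbolic_power_initial_degree_attained[OF assms] by blast
  obtain g where g: "g \<in> symbolic_power I t" "g \<noteq> 0" "homogeneous (initial_degree (symbolic_power I t)) g"
    using symbolic_power_initial_degree_attained[OF assms] by blast
  have "initial_degree (symbolic_power I (s + t)) \<le>
      initial_degree (symbolic_power I s) + initial_degree (symbolic_power I t)"
    using f g by (intro initial_degree_le[of "f * g"] symbolic_power_mult_mem[OF I] homogeneous_mult) auto
  then show "real (initial_degree (symbolic_power I (s + t))) \<le>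
      real (initial_degree (symbolic_power I s)) + real (initial_degree (symbolic_power I t))"
    by linarith
qed simp

lemma initial_degree_le_cover_weight:
  fixes \<S> :: "'n::finite set set"
  assumes "S \<in> \<S>" "S \<subseteq> T"
  shows "initial_degree (weighted_support_ideal w \<S> :: ('n, 'k::field) mpoly set) \<le> sum w T"
proof -
  \<comment> \<open>The monomial with exponent \<open>w j\<close> on \<open>T\<close> lies in the
    ideal because \<open>T\<close> contains an edge, and its degree is the weight of
    \<open>T\<close>.\<close>
  define m :: "'n \<Rightarrow>\<^sub>0 nat" where "m = Abs_poly_mapping (\<lambda>j. if j \<in> T then w j else 0)"
  have m: "Poly_Mapping.lookup m j = (if j \<in> T then w j else 0)" for j
    by (simp add: m_def)
  have "monomial m \<in> (weighted_support_ideal w \<S> :: ('n, 'k) mpoly set)"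
    using assms by (auto simp: weighted_support_ideal_def m intro!: bexI[of _ S])
  moreover have "(monomial m :: ('n, 'k) mpoly) \<noteq> 0"
    by (metis keys_monomial keys_zero insert_not_empty)
  moreover have "total_degree m = sum w T"
    by (simp add: total_degree_def m sum.If_cases)
  ultimately show ?thesis
    by (intro initial_degree_le[of "monomial m"]) (auto simp: homogeneous_def)
qed

theorem theorem3p9:
  fixes I :: "('n::{finite,linorder}, 'k::field) mpoly set"
    and h :: nat
  assumes "monomial_ideal I"
    and "I \<noteq> {0}"
    and "I \<noteq> UNIV"
    and "big_height ring_of_type_algebra I = enat h"
    and "has_standard_linear_weighting I"
  shows "waldschmidt_constant I \<ge> (real (initial_degree I) + real h - 1) / real h"
proof -
  obtain w \<S> where w: "\<And>i. w i > 0" and I: "I = weighted_support_ideal w \<S>"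
    using standard_linear_weighting_obtains[OF assms(5)] by blast
  have idl: "ideal I ring_of_type_algebra" unfolding I by (rule ideal_weighted_support_ideal)
  obtain f where f: "f \<in> I" "f \<noteq> 0"
    using idl assms(2) by (auto simp: ideal_type_iff)
  then obtain a where "a \<in> Poly_Mapping.keys f" by (meson ex_in_conv keys_eq_empty)
  then have a: "monomial a \<in> I" using f(1) by (simp add: I weighted_support_ideal_def)
  \<comment> \<open>An empty edge would impose no condition on exponents and make \<open>I\<close>
    the whole ring, so properness gives the first transversal.\<close>
  have "transversal \<S> UNIV"
    using assms(3) by (auto simp: I weighted_support_ideal_def transversal_def)
  then obtain C0 where C0: "minimal_transversal \<S> C0"
    using ex_minimal_transversal_subset[of UNIV \<S>] by auto
  have card: "card C \<le> h" if "minimal_transversal \<S> C" for C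
  proof -
    have "height ring_of_type_algebra (variable_prime C :: ('n, 'k) mpoly set) \<le>
        big_height ring_of_type_algebra I"
      unfolding big_height_def I using variable_prime_associated[OF w that] by (rule SUP_upper)
    from order_trans[OF card_le_height_variable_prime this] show ?thesis
      using assms(4) by simp
  qed
  have bound: "(real (initial_degree I) + real h - 1) / real h \<le>
      real (initial_degree (symbolic_power I s)) / real s" if s: "s \<ge> 1" for s
  proof -
    obtain f where f: "f \<in> symbolic_power I s" "f \<noteq> 0"
        "homogeneous (initial_degree (symbolic_power I s)) f"
      using symbolic_power_initial_degree_attained[OF idl a] by blast
    then obtain b where b: "b \<in> Poly_Mapping.keys f" by (meson ex_in_conv keys_eq_empty)
    \<comment> \<open>Dividing by \<open>s\<close> turns order at least \<open>s\<close> into cover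
      sum at least 1; the factor \<open>w i\<close> in the denominator makes the weighted sum of
      \<open>y\<close> equal to the degree of \<open>b\<close> over \<open>s\<close>.\<close>
    define y where "y i = real (Poly_Mapping.lookup b i) / (real (w i) * real s)" for i
    have "(real (initial_degree I) + real h - 1) / real h \<le> (\<Sum>i\<in>UNIV. real (w i) * y i)"
    \<comment> \<open>The edges to be covered are the minimal transversals; by duality their
      integral covers are the sets containing a member of \<open>\<S>\<close>.\<close>
    proof (rule fractional_cover_bound[where \<C> = "{C. minimal_transversal \<S> C}"])
      show "{C. minimal_transversal \<S> C} \<noteq> {}" using C0 by blast
      show "card C \<le> h" if "C \<in> {C. minimal_transversal \<S> C}" for C using card that by simp
      show "y i \<ge> 0" for i by (simp add: y_def)
      show "real (w i) \<ge> 1" for i using w[of i] by simp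
      show "sum y C \<ge> 1" if "C \<in> {C. minimal_transversal \<S> C}" for C
      proof -
        have "real s \<le> weighted_order w C b"
          using symbolic_power_weighted_order[OF w _ f(1)[unfolded I] b] that by simp
        moreover have "sum y C = weighted_order w C b / real s"
          by (simp add: y_def weighted_order_def sum_divide_distrib)
        ultimately show ?thesis using s by simp
      qed
      show "real (initial_degree I) \<le> (\<Sum>i\<in>T. real (w i))"
        if "transversal {C. minimal_transversal \<S> C} T" for T
      proof -
        obtain S where "S \<in> \<S>" "S \<subseteq> T"
          using \<open>transversal {C. minimal_transversal \<S> C} T\<close>
          unfolding transversal_minimal_transversals_iff by blast
        then have "initial_degree I \<le> sum w T" unfolding I by (rule initial_degree_le_cover_weight)
        then show ?thesis by (metis of_nat_mono of_nat_sum)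
      qed
    qed
    also have "(\<Sum>i\<in>UNIV. real (w i) * y i) = real (total_degree b) / real s"
    proof -
      have "real (w i) * y i = real (Poly_Mapping.lookup b i) / real s" for i
        using w[of i] by (simp add: y_def)
      then show ?thesis by (simp add: total_degree_def sum_divide_distrib)
    qed
    also have "total_degree b = initial_degree (symbolic_power I s)"
      using f(3) b by (simp add: homogeneous_def)
    finally show ?thesis .
  qed
  \<comment> \<open>Convergence ensures that \<open>lim\<close> denotes the actual limit, to which
    the bound for all \<open>s\<close> at least 1 passes.\<close>
  have "(\<lambda>s. real (initial_degree (symbolic_power I s)) / real s) \<longlonglongrightarrow> waldschmidt_constant I"
    unfolding waldschmidt_constant_def
    using convergent_initial_degree_symbolic_power[OF idl a] by (simp add: convergent_LIMSEQ_iff)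
  then show ?thesis
    by (rule LIMSEQ_le_const) (use bound in blast)
qed

end
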